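(* Let $N\ge 2$ be an integer, $\alpha\in(0,1)$, $\lambda>0$ and $f\in L^2(\mathbb{T},\mu)$. Let $$\mathcal{J}(w)=\frac12\mathcal{E}_\alpha(w)+\frac{\lambda}{2}\|w\|_{L^2(\mathbb{T},\mu)}^2-\int_{\mathbb{T}}fw\,d\mu,\qquad w\in\mathcal{H}_\alpha(\mathbb{T}).$$ A function $u\in\mathcal{H}_\alpha(\mathbb{T})$ is the unique minimizer of $\mathcal{J}$ on $\mathcal{H}_\alpha(\mathbb{T})$ if and only if it is the unique weak solution of the hybrid nonlocal problem associated with $(\lambda,f)$, i.e. the unique element of $\mathcal{H}_\alpha(\mathbb{T})$ satisfying $$\mathfrak{a}(u,\varphi)+\lambda\int_{\mathbb{T}}u\varphi\,d\mu=\int_{\mathbb{T}}f\varphi\,d\mu\qquad\text{for every }\varphi\in\mathcal{H}_\alpha(\mathbb{T}).$$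
   Context: Let $D=\{2,3,\dots,N+1\}$ and $\mathbb{T}=[0,1]\cup D\subset\mathbb{R}$, with the positive finite Borel measure $\mu(A)=\int_{A\cap[0,1]}dx+\sum_{k=2}^{N+1}\delta_k(A)$, so that $\int_{\mathbb{T}} f\,d\mu=\int_0^1 f(x)\,dx+\sum_{k=2}^{N+1}f(k)$. A function $u:\mathbb{T}\to\mathbb{R}$ is written $u=(v,a_2,\dots,a_{N+1})$ with $v=u|_{[0,1]}$ and $a_k=u(k)$. The Gagliardo seminorm is $[v]_{H^\alpha(0,1)}^2=\int_0^1\int_0^1\frac{|v(x)-v(y)|^2}{|x-y|^{1+2\alpha}}\,dx\,dy$, and $H^\alpha(0,1)=\{v\in L^2(0,1):[v]_{H^\alpha(0,1)}<\infty\}$. The hybrid energy space is $\mathcal{H}_\alpha(\mathbb{T})=\{u=(v,a_2,\dots,a_{N+1}): v\in H^\alpha(0,1),\ a_k\in\mathbb{R}\}$ (functions identified when equal $\mu$-a.e.). The energy is $\mathcal{E}_\alpha(u)=\iint_{\mathbb{T}\times\mathbb{T}}\frac{|u(x)-u(y)|^2}{|x-y|^{1+2\alpha}}\,d\mu(x)\,d\mu(y)$ and the associated bilinear form is $\mathfrak{a}(u,\varphi)=\iint_{\mathbb{T}\times\mathbb{T}}\frac{(u(x)-u(y))(\varphi(x)-\varphi(y))}{|x-y|^{1+2\alpha}}\,d\mu(x)\,d\mu(y)$, where both integrands are taken to be $0$ on the diagonal $x=y$. *)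

theory Defs
  imports "HOL-Analysis.Analysis"
begin

definition hybrid_atoms :: "nat \<Rightarrow> real set" where
  "hybrid_atoms N = real ` {2..N+1}"

definition hybrid_set :: "nat \<Rightarrow> real set" where
  "hybrid_set N = {0..1} \<union> hybrid_atoms N"

definition hybrid_measure :: "nat \<Rightarrow> real measure" where
  "hybrid_measure N =
     measure_of (hybrid_set N) (sets (restrict_space borel (hybrid_set N)))
       (\<lambda>A. emeasure lborel (A \<inter> {0..1}) + (\<Sum>k\<in>{2..N+1}. indicator A (real k)))"

definition L2_fun :: "'a measure \<Rightarrow> ('a \<Rightarrow> real) \<Rightarrow> bool" where
  "L2_fun M f \<longleftrightarrow> f \<in> borel_measurable M \<and> integrable M (\<lambda>x. (f x)\<^sup>2)"

definition L2_fun_norm :: "'a measure \<Rightarrow> ('a \<Rightarrow> real) \<Rightarrow> real" where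
  "L2_fun_norm M f = sqrt (\<integral>x. (f x)\<^sup>2 \<partial>M)"

abbreviation unit_interval_measure :: "real measure" where
  "unit_interval_measure \<equiv> restrict_space lborel {0<..<1}"

text \<open>All difference quotients below vanish on the diagonal, since \<open>0 / 0 = 0\<close>.
  The seminorm is taken in \<open>[0, \<infinity>]\<close> because its finiteness is the condition
  defining the fractional Sobolev space.\<close>

definition gagliardo_seminorm_sq :: "real \<Rightarrow> (real \<Rightarrow> real) \<Rightarrow> ennreal" where
  "gagliardo_seminorm_sq \<alpha> v =
     (\<integral>\<^sup>+x. (\<integral>\<^sup>+y. ennreal (\<bar>v x - v y\<bar>\<^sup>2 / \<bar>x - y\<bar> powr (1 + 2 * \<alpha>))
        \<partial>unit_interval_measure) \<partial>unit_interval_measure)"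

definition frac_sobolev :: "real \<Rightarrow> (real \<Rightarrow> real) set" where
  "frac_sobolev \<alpha> = {v. L2_fun unit_interval_measure v \<and> gagliardo_seminorm_sq \<alpha> v < \<infinity>}"

text \<open>Elements of the space are actual functions on \<^term>\<open>hybrid_set N\<close>; the identification
  of functions that agree almost everywhere is expressed by \<open>unique_member_AE\<close> below.\<close>

definition hybrid_space :: "nat \<Rightarrow> real \<Rightarrow> (real \<Rightarrow> real) set" where
  "hybrid_space N \<alpha> = {u \<in> hybrid_set N \<rightarrow>\<^sub>E UNIV. restrict u {0..1} \<in> frac_sobolev \<alpha>}"

definition hybrid_energy :: "nat \<Rightarrow> real \<Rightarrow> (real \<Rightarrow> real) \<Rightarrow> real" where
  "hybrid_energy N \<alpha> u =
     (\<integral>(x, y). \<bar>u x - u y\<bar>\<^sup>2 / \<bar>x - y\<bar> powr (1 + 2 * \<alpha>)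
        \<partial>(hybrid_measure N \<Otimes>\<^sub>M hybrid_measure N))"

definition hybrid_form :: "nat \<Rightarrow> real \<Rightarrow> (real \<Rightarrow> real) \<Rightarrow> (real \<Rightarrow> real) \<Rightarrow> real" where
  "hybrid_form N \<alpha> u \<phi> =
     (\<integral>(x, y). (u x - u y) * (\<phi> x - \<phi> y) / \<bar>x - y\<bar> powr (1 + 2 * \<alpha>)
        \<partial>(hybrid_measure N \<Otimes>\<^sub>M hybrid_measure N))"

definition hybrid_functional ::
    "nat \<Rightarrow> real \<Rightarrow> real \<Rightarrow> (real \<Rightarrow> real) \<Rightarrow> (real \<Rightarrow> real) \<Rightarrow> real" where
  "hybrid_functional N \<alpha> lam f w =
     1 / 2 * hybrid_energy N \<alpha> w + lam / 2 * (L2_fun_norm (hybrid_measure N) w)\<^sup>2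
       - (\<integral>x. f x * w x \<partial>hybrid_measure N)"

definition hybrid_minimizers ::
    "nat \<Rightarrow> real \<Rightarrow> real \<Rightarrow> (real \<Rightarrow> real) \<Rightarrow> (real \<Rightarrow> real) set" where
  "hybrid_minimizers N \<alpha> lam f =
     {u \<in> hybrid_space N \<alpha>. \<forall>w\<in>hybrid_space N \<alpha>.
        hybrid_functional N \<alpha> lam f u \<le> hybrid_functional N \<alpha> lam f w}"

definition hybrid_weak_solutions ::
    "nat \<Rightarrow> real \<Rightarrow> real \<Rightarrow> (real \<Rightarrow> real) \<Rightarrow> (real \<Rightarrow> real) set" where
  "hybrid_weak_solutions N \<alpha> lam f =
     {u \<in> hybrid_space N \<alpha>. \<forall>\<phi>\<in>hybrid_space N \<alpha>.
        hybrid_form N \<alpha> u \<phi> + lam * (\<integral>x. u x * \<phi> x \<partial>hybrid_measure N)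
          = (\<integral>x. f x * \<phi> x \<partial>hybrid_measure N)}"

text \<open>\<open>u\<close> is the only member of \<open>S\<close>, up to equality almost everywhere.\<close>

definition unique_member_AE :: "'a measure \<Rightarrow> ('a \<Rightarrow> real) set \<Rightarrow> ('a \<Rightarrow> real) \<Rightarrow> bool" where
  "unique_member_AE M S u \<longleftrightarrow> u \<in> S \<and> (\<forall>w\<in>S. AE x in M. w x = u x)"

text \<open>\<^const>\<open>measure_of\<close> silently returns the null measure when its last argument is not
  countably additive; the following lemmas show that this does not happen here.\<close>

lemma hybrid_set_borel: "hybrid_set N \<in> sets borel"
  by (simp add: hybrid_set_def hybrid_atoms_def borel_closed finite_imp_closed)

lemma space_hybrid_measure: "space (hybrid_measure N) = hybrid_set N"
  unfolding hybrid_measure_def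
  by (rule space_measure_of) (auto dest!: sets.sets_into_space simp: space_restrict_space)

lemma sets_hybrid_measure: "sets (hybrid_measure N) = sets (restrict_space borel (hybrid_set N))"
  unfolding hybrid_measure_def
  using sets.sets_measure_of_eq[of "restrict_space borel (hybrid_set N)"]
  by (simp add: space_restrict_space)

lemma emeasure_hybrid_measure:
  assumes "A \<in> sets (hybrid_measure N)"
  shows "emeasure (hybrid_measure N) A =
    emeasure lborel (A \<inter> {0..1}) + (\<Sum>k\<in>{2..N+1}. indicator A (real k))"
proof (rule emeasure_measure_of[OF hybrid_measure_def _ _ _ assms])
  show "sets (restrict_space borel (hybrid_set N)) \<subseteq> Pow (hybrid_set N)"
    by (auto dest!: sets.sets_into_space simp: space_restrict_space)
  let ?\<mu> = "\<lambda>A. emeasure lborel (A \<inter> {0..1}) + (\<Sum>k\<in>{2..N+1}. indicator A (real k)) :: ennreal"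
  show "positive (sets (hybrid_measure N)) ?\<mu>"
    by (simp add: positive_def)
  show "countably_additive (sets (hybrid_measure N)) ?\<mu>"
  proof (rule countably_additiveI)
    fix B :: "nat \<Rightarrow> real set"
    assume B: "range B \<subseteq> sets (hybrid_measure N)" "disjoint_family B"
    have "range B \<subseteq> sets borel"
      using B(1) hybrid_set_borel
      by (auto simp: sets_hybrid_measure sets_restrict_space_iff)
    then have "range (\<lambda>i. B i \<inter> {0..1}) \<subseteq> sets lborel"
      by auto
    moreover have "disjoint_family (\<lambda>i. B i \<inter> {0..1})"
      using B(2) by (auto simp: disjoint_family_on_def)
    ultimately have "(\<Sum>i. emeasure lborel (B i \<inter> {0..1})) = emeasure lborel (\<Union>i. B i \<inter> {0..1})"
      by (rule suminf_emeasure)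
    moreover have "(\<Sum>i. indicator (B i) (real k)) = (indicator (\<Union>i. B i) (real k) :: ennreal)" for k
      using B(2) by (rule suminf_indicator)
    moreover have "(\<Sum>i. \<Sum>k\<in>{2..N+1}. indicator (B i) (real k) :: ennreal)
        = (\<Sum>k\<in>{2..N+1}. \<Sum>i. indicator (B i) (real k))"
      by (rule suminf_sum) auto
    ultimately show "(\<Sum>i. ?\<mu> (B i)) = ?\<mu> (\<Union>i. B i)"
      by (simp add: suminf_add[symmetric] UN_extend_simps del: UN_simps)
  qed
qed

lemma finite_measure_hybrid_measure: "finite_measure (hybrid_measure N)"
proof (rule finite_measureI)
  have "emeasure lborel (hybrid_set N \<inter> {0..1}) \<le> emeasure lborel {0..1::real}"
    by (rule emeasure_mono) auto
  then have "emeasure lborel (hybrid_set N \<inter> {0..1}) < \<infinity>"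
    by (simp add: le_less_trans)
  moreover have "(\<Sum>k\<in>{2..N+1}. indicator (hybrid_set N) (real k) :: ennreal) < \<infinity>"
    by (simp add: indicator_def of_bool_def)
  ultimately show "emeasure (hybrid_measure N) (space (hybrid_measure N)) \<noteq> \<infinity>"
    using sets.top[of "hybrid_measure N"]
    by (subst emeasure_hybrid_measure) (auto simp: space_hybrid_measure split: split_indicator_asm)
qed

end

theory Submission
  imports Defs
begin

text \<open>Along a line, \<open>J(u + t\<phi>) = J(u) + t L + t\<^sup>2 Q\<close>, where \<open>L\<close> is the residual of the weak equation
  tested with \<open>\<phi>\<close> and \<open>Q \<ge> 0\<close>. Hence the minimizers and the weak solutions are the same set, and
  uniqueness in one sense is uniqueness in the other. The expansion needs the energy integrand of
  every element of the space to be integrable.\<close>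

section \<open>Elementary inequalities and the quadratic expansion of weighted squares\<close>

text \<open>The denominator is at least 1, and (a + b)^2 \<ge> 0 gives (a - b)^2 \<le> 2a^2 + 2b^2.
  This controls the kernel between the interval and an atom by L^2 data alone.\<close>

lemma difference_quotient_le:
  fixes a b d s :: real
  assumes "1 \<le> \<bar>d\<bar>" "0 \<le> s"
  shows "\<bar>a - b\<bar>\<^sup>2 / \<bar>d\<bar> powr s \<le> 2 * a\<^sup>2 + 2 * b\<^sup>2"
proof -
  have "\<bar>a - b\<bar>\<^sup>2 / \<bar>d\<bar> powr s \<le> \<bar>a - b\<bar>\<^sup>2 / 1"
    using assms by (intro divide_left_mono) (auto intro: ge_one_powr_ge_zero)
  also have "\<dots> \<le> 2 * a\<^sup>2 + 2 * b\<^sup>2"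
    using zero_le_power2[of "a + b"] by (simp add: power2_eq_square algebra_simps)
  finally show ?thesis .
qed

text \<open>First-order optimality: near t = 0 a nonzero linear term dominates the quadratic one,
  and t may take either sign.\<close>

lemma linear_coeff_eq_0_if_quadratic_nonneg:
  fixes L Q :: real
  assumes "\<And>t. 0 \<le> t * L + t\<^sup>2 * Q"
  shows "L = 0"
proof (rule ccontr)
  assume "L \<noteq> 0"
  \<comment> \<open>Any positive c > Q serves: at t = -L/c the polynomial equals L^2/c^2 * (Q - c),
    which is negative.\<close>
  define c where "c = \<bar>Q\<bar> + 1"
  have "0 < c" "Q < c"
    by (auto simp: c_def)
  have "0 \<le> (- L / c) * L + (- L / c)\<^sup>2 * Q"
    by (rule assms)
  also have "\<dots> = L\<^sup>2 / c\<^sup>2 * (Q - c)"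
    using \<open>0 < c\<close> by (simp add: field_simps power2_eq_square)
  also have "\<dots> < 0"
    using \<open>L \<noteq> 0\<close> \<open>0 < c\<close> \<open>Q < c\<close> by (intro mult_pos_neg) auto
  finally show False
    by simp
qed

text \<open>By the arithmetic-geometric mean inequality, |gh|k is dominated by (g^2 + h^2)k. The
  weight k = 1 serves L^2 pairings, the singular kernel serves \<open>hybrid_form\<close>.\<close>

lemma integrable_weighted_product:
  fixes g h k :: "'a \<Rightarrow> real"
  assumes [measurable]: "g \<in> borel_measurable M" "h \<in> borel_measurable M" "k \<in> borel_measurable M"
    and k: "\<And>x. 0 \<le> k x"
    and int: "integrable M (\<lambda>x. (g x)\<^sup>2 * k x)" "integrable M (\<lambda>x. (h x)\<^sup>2 * k x)"
  shows "integrable M (\<lambda>x. g x * h x * k x)"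
proof (rule Bochner_Integration.integrable_bound[OF Bochner_Integration.integrable_add[OF int]])
  have "\<bar>a * b * c\<bar> \<le> \<bar>a\<^sup>2 * c + b\<^sup>2 * c\<bar>" if "0 \<le> c" for a b c :: real
  proof -
    have "2 * \<bar>a\<bar> * \<bar>b\<bar> \<le> a\<^sup>2 + b\<^sup>2"
      using sum_squares_bound[of "\<bar>a\<bar>" "\<bar>b\<bar>"] by simp
    then have "\<bar>a * b\<bar> \<le> a\<^sup>2 + b\<^sup>2"
      using abs_ge_zero[of "a * b"] by (simp only: abs_mult)
    then have "\<bar>a * b\<bar> * c \<le> (a\<^sup>2 + b\<^sup>2) * c"
      using that by (rule mult_right_mono)
    then show ?thesis
      using that by (simp add: abs_mult algebra_simps)
  qed
  then show "AE x in M. norm (g x * h x * k x) \<le> norm ((g x)\<^sup>2 * k x + (h x)\<^sup>2 * k x)"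
    using k by simp
qed measurable

text \<open>One expansion for both the energy and the L^2 norm; its integrability half makes the
  function spaces closed under v + t\<phi>. Integrability of the cross term is what lets the Bochner
  integral be split.\<close>

lemma weighted_square_expansion:
  fixes g h k :: "'a \<Rightarrow> real"
  assumes "g \<in> borel_measurable M" "h \<in> borel_measurable M" "k \<in> borel_measurable M"
    and "\<And>x. 0 \<le> k x"
    and int: "integrable M (\<lambda>x. (g x)\<^sup>2 * k x)" "integrable M (\<lambda>x. (h x)\<^sup>2 * k x)"
  shows "integrable M (\<lambda>x. (g x + t * h x)\<^sup>2 * k x)" (is ?integrable)
    and "(\<integral>x. (g x + t * h x)\<^sup>2 * k x \<partial>M) =
      (\<integral>x. (g x)\<^sup>2 * k x \<partial>M) + 2 * t * (\<integral>x. g x * h x * k x \<partial>M) + t\<^sup>2 * (\<integral>x. (h x)\<^sup>2 * k x \<partial>M)"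
      (is ?expansion)
proof -
  have eq: "(\<lambda>x. (g x + t * h x)\<^sup>2 * k x) =
      (\<lambda>x. (g x)\<^sup>2 * k x + 2 * t * (g x * h x * k x) + t\<^sup>2 * ((h x)\<^sup>2 * k x))"
    by (simp add: fun_eq_iff power2_eq_square algebra_simps)
  have prod: "integrable M (\<lambda>x. g x * h x * k x)"
    using assms by (rule integrable_weighted_product)
  show ?integrable
    unfolding eq
    by (intro Bochner_Integration.integrable_add integrable_mult_right int prod)
  show ?expansion
    unfolding eq using int prod by simp
qed

section \<open>Gagliardo integrability over a general measure on the line\<close>

text \<open>Only measurability of the identity is asked of M, which covers both the interval measure
  and the hybrid measure. The kernel is 0 on the diagonal, since \<open>0 powr s = 0\<close> and
  \<open>inverse 0 = 0\<close>.\<close>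

lemma measurable_difference_kernel:
  fixes g :: "real \<Rightarrow> real" and s :: real
  assumes [measurable]: "(\<lambda>x. x) \<in> borel_measurable M" "g \<in> borel_measurable M"
  shows "(\<lambda>p. g (fst p) - g (snd p)) \<in> borel_measurable (M \<Otimes>\<^sub>M M)"
    and "(\<lambda>p. inverse (\<bar>fst p - snd p\<bar> powr s)) \<in> borel_measurable (M \<Otimes>\<^sub>M M)"
proof -
  have 1: "(\<lambda>p. fst p :: real) \<in> borel_measurable (M \<Otimes>\<^sub>M M)"
    using measurable_compose[OF measurable_fst assms(1)] by simp
  have 2: "(\<lambda>p. snd p :: real) \<in> borel_measurable (M \<Otimes>\<^sub>M M)"
    using measurable_compose[OF measurable_snd assms(1)] by simp
  show "(\<lambda>p. g (fst p) - g (snd p)) \<in> borel_measurable (M \<Otimes>\<^sub>M M)"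
    by measurable
  show "(\<lambda>p. inverse (\<bar>fst p - snd p\<bar> powr s)) \<in> borel_measurable (M \<Otimes>\<^sub>M M)"
    using 1 2 by measurable
qed

text \<open>Leaving M free allows the same condition on (0,1) and on the hybrid set. The shape
  square times weight is the one that \<open>weighted_square_expansion\<close> takes.\<close>

definition gagliardo_integrable :: "real measure \<Rightarrow> real \<Rightarrow> (real \<Rightarrow> real) \<Rightarrow> bool" where
  "gagliardo_integrable M \<alpha> v \<longleftrightarrow>
     integrable (M \<Otimes>\<^sub>M M)
       (\<lambda>p. (v (fst p) - v (snd p))\<^sup>2 * inverse (\<bar>fst p - snd p\<bar> powr (1 + 2 * \<alpha>)))"

text \<open>Tonelli: the integrand is nonnegative and measurable, so integrability on the product is
  finiteness of the iterated integral.\<close>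

lemma gagliardo_integrable_iff:
  fixes M :: "real measure"
  assumes "sigma_finite_measure M" and id: "(\<lambda>x. x) \<in> borel_measurable M" and v: "v \<in> borel_measurable M"
  shows "gagliardo_integrable M \<alpha> v \<longleftrightarrow>
    (\<integral>\<^sup>+x. (\<integral>\<^sup>+y. ennreal (\<bar>v x - v y\<bar>\<^sup>2 / \<bar>x - y\<bar> powr (1 + 2 * \<alpha>)) \<partial>M) \<partial>M) < \<infinity>"
proof -
  interpret sigma_finite_measure M
    by fact
  let ?F = "\<lambda>p. (v (fst p) - v (snd p))\<^sup>2 * inverse (\<bar>fst p - snd p\<bar> powr (1 + 2 * \<alpha>))"
  have [measurable]: "?F \<in> borel_measurable (M \<Otimes>\<^sub>M M)"
    using measurable_difference_kernel[OF id v] by measurable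
  have "(\<integral>\<^sup>+p. ennreal (?F p) \<partial>(M \<Otimes>\<^sub>M M)) =
      (\<integral>\<^sup>+x. (\<integral>\<^sup>+y. ennreal (\<bar>v x - v y\<bar>\<^sup>2 / \<bar>x - y\<bar> powr (1 + 2 * \<alpha>)) \<partial>M) \<partial>M)"
    by (subst nn_integral_fst[symmetric]) (simp_all add: divide_inverse)
  moreover have "integrable (M \<Otimes>\<^sub>M M) ?F \<longleftrightarrow> (\<integral>\<^sup>+p. ennreal (?F p) \<partial>(M \<Otimes>\<^sub>M M)) < \<infinity>"
    by (simp add: integrable_iff_bounded)
  ultimately show ?thesis
    by (simp add: gagliardo_integrable_def)
qed

section \<open>Linear structure of the fractional Sobolev space and of the hybrid space\<close>

lemma finite_measure_unit_interval_measure: "finite_measure unit_interval_measure"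
  by (rule finite_measureI) (simp add: emeasure_restrict_space space_restrict_space)

lemmas sigma_finite_unit_interval_measure =
  finite_measure.axioms(1)[OF finite_measure_unit_interval_measure]

lemma measurable_id_unit_interval: "(\<lambda>x. x) \<in> borel_measurable unit_interval_measure"
  by (simp add: measurable_restrict_space1)

lemma frac_sobolev_iff:
  "v \<in> frac_sobolev \<alpha> \<longleftrightarrow>
    L2_fun unit_interval_measure v \<and> gagliardo_integrable unit_interval_measure \<alpha> v"
  using gagliardo_integrable_iff
      [OF sigma_finite_unit_interval_measure measurable_id_unit_interval]
  by (auto simp: frac_sobolev_def gagliardo_seminorm_sq_def L2_fun_def)

lemma L2_fun_add_scaled:
  assumes "L2_fun M v" "L2_fun M \<phi>"
  shows "L2_fun M (\<lambda>x. v x + t * \<phi> x)"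
  using assms weighted_square_expansion(1)[of v M \<phi> "\<lambda>_. 1" t]
  unfolding L2_fun_def by auto

lemma L2_fun_cong: "(\<And>x. x \<in> space M \<Longrightarrow> v x = w x) \<Longrightarrow> L2_fun M v \<longleftrightarrow> L2_fun M w"
  unfolding L2_fun_def by (intro conj_cong measurable_cong Bochner_Integration.integrable_cong) simp_all

lemma gagliardo_integrable_cong:
  "(\<And>x. x \<in> space M \<Longrightarrow> v x = w x) \<Longrightarrow> gagliardo_integrable M \<alpha> v \<longleftrightarrow> gagliardo_integrable M \<alpha> w"
  unfolding gagliardo_integrable_def
  by (intro Bochner_Integration.integrable_cong) (auto simp: space_pair_measure)

text \<open>Taking differences is linear, so \<open>weighted_square_expansion\<close> applies on the
  product space to the differences of v and of \<phi>.\<close>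

lemma gagliardo_integrable_add_scaled:
  assumes "(\<lambda>x. x) \<in> borel_measurable M" "v \<in> borel_measurable M" "\<phi> \<in> borel_measurable M"
    and "gagliardo_integrable M \<alpha> v" "gagliardo_integrable M \<alpha> \<phi>"
  shows "gagliardo_integrable M \<alpha> (\<lambda>x. v x + t * \<phi> x)"
proof -
  have eq: "v x + t * \<phi> x - (v y + t * \<phi> y) = (v x - v y) + t * (\<phi> x - \<phi> y)" for x y
    by (simp add: algebra_simps)
  show ?thesis
    unfolding gagliardo_integrable_def eq
    by (rule weighted_square_expansion(1)[OF measurable_difference_kernel(1)[OF assms(1,2)]
          measurable_difference_kernel(1)[OF assms(1,3)] measurable_difference_kernel(2)[OF assms(1,2)]
          _ assms(4,5)[unfolded gagliardo_integrable_def]]) simp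
qed

lemma frac_sobolev_add_scaled:
  assumes "v \<in> frac_sobolev \<alpha>" "\<phi> \<in> frac_sobolev \<alpha>"
  shows "(\<lambda>x. v x + t * \<phi> x) \<in> frac_sobolev \<alpha>"
  using assms L2_fun_add_scaled gagliardo_integrable_add_scaled[OF measurable_id_unit_interval]
  by (auto simp: frac_sobolev_iff L2_fun_def)

text \<open>\<open>unit_interval_measure\<close> has underlying space (0,1), so changing values
  outside [0,1] is invisible to it.\<close>

lemma frac_sobolev_restrict: "restrict u {0..1} \<in> frac_sobolev \<alpha> \<longleftrightarrow> u \<in> frac_sobolev \<alpha>"
  unfolding frac_sobolev_iff
  by (intro conj_cong L2_fun_cong gagliardo_integrable_cong)
    (auto simp: space_restrict_space)

lemma hybrid_space_iff: "u \<in> hybrid_space N \<alpha> \<longleftrightarrow> u \<in> extensional (hybrid_set N) \<and> u \<in> frac_sobolev \<alpha>"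
  by (auto simp: hybrid_space_def frac_sobolev_restrict PiE_def)

text \<open>The outer \<open>restrict\<close> restores extensionality: off the hybrid set the sum of
  two undefined values need not be \<open>undefined\<close>.\<close>

lemma hybrid_space_add_scaled:
  assumes "v \<in> hybrid_space N \<alpha>" "\<phi> \<in> hybrid_space N \<alpha>"
  shows "restrict (\<lambda>x. v x + t * \<phi> x) (hybrid_set N) \<in> hybrid_space N \<alpha>"
proof -
  have "restrict (\<lambda>x. v x + t * \<phi> x) (hybrid_set N) \<in> frac_sobolev \<alpha> \<longleftrightarrow>
      (\<lambda>x. v x + t * \<phi> x) \<in> frac_sobolev \<alpha>"
    unfolding frac_sobolev_iff
    by (intro conj_cong L2_fun_cong gagliardo_integrable_cong)
      (auto simp: space_restrict_space hybrid_set_def)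
  then show ?thesis
    using assms frac_sobolev_add_scaled by (auto simp: hybrid_space_iff)
qed

section \<open>The functional, and measurability for the hybrid measure\<close>

lemma L2_fun_norm_sq: "(L2_fun_norm M w)\<^sup>2 = (\<integral>x. (w x)\<^sup>2 \<partial>M)"
  by (simp add: L2_fun_norm_def)

lemma hybrid_energy_nonneg: "0 \<le> hybrid_energy N \<alpha> w"
  unfolding hybrid_energy_def by (intro integral_nonneg_AE) auto

text \<open>The hybrid set is (0,1) together with finitely many points (the endpoints and the
  atoms), so a preimage gains only a finite, hence closed, set.\<close>

lemma measurable_hybrid_measureI:
  fixes g :: "real \<Rightarrow> real"
  assumes "g \<in> borel_measurable unit_interval_measure"
  shows "g \<in> borel_measurable (hybrid_measure N)"
proof (rule measurableI)
  fix B :: "real set" assume B: "B \<in> sets borel"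
  let ?F = "{0, 1} \<union> hybrid_atoms N"
  have "g -` B \<inter> {0<..<1} \<in> sets unit_interval_measure"
    using measurable_sets[OF assms B] by (simp add: space_restrict_space)
  then have "g -` B \<inter> {0<..<1} \<in> sets borel"
    by (simp add: sets_restrict_space_iff)
  moreover have "g -` B \<inter> ?F \<in> sets borel"
    by (intro borel_closed finite_imp_closed) (simp add: hybrid_atoms_def)
  ultimately have "(g -` B \<inter> {0<..<1}) \<union> (g -` B \<inter> ?F) \<in> sets borel"
    by (rule sets.Un)
  moreover have "(g -` B \<inter> {0<..<1}) \<union> (g -` B \<inter> ?F) = g -` B \<inter> hybrid_set N"
    by (auto simp: hybrid_set_def)
  ultimately show "g -` B \<inter> space (hybrid_measure N) \<in> sets (hybrid_measure N)"
    using hybrid_set_borel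
    by (simp add: space_hybrid_measure sets_hybrid_measure sets_restrict_space_iff)
qed simp

lemma measurable_hybrid_measureD:
  assumes "g \<in> measurable (hybrid_measure N) L"
  shows "g \<in> measurable unit_interval_measure L"
proof -
  have "g \<in> measurable (restrict_space borel (hybrid_set N)) L"
    using assms by (simp cong: measurable_cong_sets add: sets_hybrid_measure)
  then have "g \<in> measurable (restrict_space borel {0<..<1}) L"
    by (rule measurable_restrict_mono) (auto simp: hybrid_set_def)
  moreover have "sets unit_interval_measure = sets (restrict_space borel {0<..<1::real})"
    by (simp add: sets_restrict_space)
  ultimately show ?thesis
    by (simp cong: measurable_cong_sets)
qed

lemma measurable_id_hybrid: "(\<lambda>x. x) \<in> borel_measurable (hybrid_measure N)"
  by (rule measurable_hybrid_measureI) (rule measurable_id_unit_interval)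

text \<open>Lets \<open>restrict\<close> be dropped from a competitor before the functional is
  expanded.\<close>

lemma hybrid_functional_cong:
  assumes "\<And>x. x \<in> hybrid_set N \<Longrightarrow> v x = w x"
  shows "hybrid_functional N \<alpha> lam f v = hybrid_functional N \<alpha> lam f w"
proof -
  have "hybrid_energy N \<alpha> v = hybrid_energy N \<alpha> w"
    unfolding hybrid_energy_def
    by (rule Bochner_Integration.integral_cong)
      (auto simp: space_pair_measure space_hybrid_measure assms)
  moreover have "(\<integral>x. (v x)\<^sup>2 \<partial>hybrid_measure N) = (\<integral>x. (w x)\<^sup>2 \<partial>hybrid_measure N)"
    "(\<integral>x. f x * v x \<partial>hybrid_measure N) = (\<integral>x. f x * w x \<partial>hybrid_measure N)"
    by (rule Bochner_Integration.integral_cong; simp add: space_hybrid_measure assms)+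
  ultimately show ?thesis
    by (simp add: hybrid_functional_def L2_fun_norm_sq)
qed

section \<open>Finiteness of the energy on the hybrid space, and equality of the two solution
  sets\<close>

lemma hybrid_minimizers_eq_weak_solutions:
  assumes "0 < \<alpha>" and "0 \<le> lam" and "L2_fun (hybrid_measure N) f"
  shows "hybrid_minimizers N \<alpha> lam f = hybrid_weak_solutions N \<alpha> lam f"
proof -
  let ?H = "hybrid_measure N" and ?U = unit_interval_measure
  let ?J = "hybrid_functional N \<alpha> lam f"
  have restrict_H: "restrict_space ?H {0<..<1} = ?U"
  proof (rule measure_eqI)
    have sub: "{0<..<1} \<inter> hybrid_set N = {0<..<1}"
      by (auto simp: hybrid_set_def)
    have H: "{0<..<1} \<in> sets (hybrid_measure N)"
      using hybrid_set_borel
      by (auto simp: sets_hybrid_measure sets_restrict_space_iff hybrid_set_def)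
    show sets: "sets (restrict_space (hybrid_measure N) {0<..<1}) = sets unit_interval_measure"
      unfolding sets_restrict_space sets_hybrid_measure
      by (simp add: image_image Int_assoc[symmetric] sub)
    fix A assume "A \<in> sets (restrict_space (hybrid_measure N) {0<..<1})"
    then have A: "A \<in> sets (hybrid_measure N)" "A \<subseteq> {0<..<1}"
      using H by (simp_all add: sets_restrict_space_iff sets.Int_space_eq2)
    have "A \<inter> {0..1} = A"
      using A(2) by fastforce
    \<comment> \<open>The atoms start at 2, so none lies in a subset of (0,1).\<close>
    moreover have "(\<Sum>k\<in>{2..N+1}. indicator A (real k) :: ennreal) = 0"
      using A(2) by (intro sum.neutral) (fastforce simp: indicator_def)
    ultimately show "emeasure (restrict_space (hybrid_measure N) {0<..<1}) A = emeasure unit_interval_measure A"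
      using A H by (simp add: emeasure_restrict_space sets.Int_space_eq2 emeasure_hybrid_measure)
  qed
  \<comment> \<open>The integration formula for \<mu>, over the open interval: the part on (0,1)
    comes from \<open>restrict_H\<close>, the rest is a finite sum of point masses.\<close>
  have nn_integral_H: "(\<integral>\<^sup>+x. g x \<partial>?H) = (\<integral>\<^sup>+x. g x \<partial>?U) + (\<Sum>k\<in>{2..N+1}. g (real k))"
    if g: "g \<in> borel_measurable ?H" for g
  proof -
    let ?F = "{0, 1} \<union> hybrid_atoms N"
    have meas: "A \<in> sets ?H" if "A \<in> sets borel" "A \<subseteq> hybrid_set N" for A
      using that hybrid_set_borel by (auto simp: sets_hybrid_measure sets_restrict_space_iff)
    have fin: "finite (hybrid_atoms N)"
      by (simp add: hybrid_atoms_def)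
    have single: "{x} \<in> sets ?H" if "x \<in> ?F" for x
      using that by (intro meas) (auto simp: hybrid_set_def)
    have I: "{0<..<1} \<in> sets ?H"
      by (intro meas) (auto simp: hybrid_set_def)
    have F: "?F \<in> sets ?H"
      by (intro meas borel_closed finite_imp_closed) (auto simp: hybrid_set_def fin)
    have "(\<integral>\<^sup>+x. g x \<partial>?H) = (\<integral>\<^sup>+x. g x * indicator {0<..<1} x + g x * indicator ?F x \<partial>?H)"
      by (intro nn_integral_cong)
        (auto simp: space_hybrid_measure hybrid_set_def hybrid_atoms_def split: split_indicator)
    also have "\<dots> = (\<integral>\<^sup>+x. g x * indicator {0<..<1} x \<partial>?H) + (\<integral>\<^sup>+x. g x * indicator ?F x \<partial>?H)"
      using g I F by (intro nn_integral_add borel_measurable_times_ennreal borel_measurable_indicator)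
    also have "(\<integral>\<^sup>+x. g x * indicator {0<..<1} x \<partial>?H) = (\<integral>\<^sup>+x. g x \<partial>unit_interval_measure)"
      using nn_integral_restrict_space[of "{0<..<1}" ?H g] I
      by (simp add: restrict_H sets.Int_space_eq2)
    also have "(\<integral>\<^sup>+x. g x * indicator ?F x \<partial>?H) = (\<Sum>x\<in>?F. g x * emeasure ?H {x})"
      using fin single by (intro nn_integral_indicator_finite) auto
    \<comment> \<open>The endpoints 0 and 1 drop out: they are Lebesgue null and carry no point
      mass.\<close>
    also have "\<dots> = (\<Sum>x\<in>hybrid_atoms N. g x * emeasure ?H {x})"
      by (intro sum.mono_neutral_right)
        (auto simp: fin emeasure_hybrid_measure[OF single])
    also have "\<dots> = (\<Sum>k\<in>{2..N+1}. g (real k))"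
      unfolding hybrid_atoms_def sum.reindex[OF inj_on_of_nat] comp_def
    proof (rule sum.cong)
      fix k assume k: "k \<in> {2..N+1}"
      then have "emeasure ?H {real k} = emeasure lborel ({real k} \<inter> {0..1}) + (\<Sum>l\<in>{2..N+1}. indicator {real k} (real l))"
        by (intro emeasure_hybrid_measure single) (auto simp: hybrid_atoms_def)
      also have "{real k} \<inter> {0..1} = {}"
        using k by auto
      also have "(\<Sum>l\<in>{2..N+1}. indicator {real k} (real l)) = (\<Sum>l\<in>{2..N+1}. if l = k then 1 else 0 :: ennreal)"
        by (intro sum.cong) (auto split: split_indicator)
      also have "\<dots> = 1"
        using k by (simp only: sum.delta finite_atLeastAtMost if_True)
      finally show "g (real k) * emeasure ?H {real k} = g (real k)"
        by simp
    qed simp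
    finally show ?thesis .
  qed
  \<comment> \<open>The atoms add only finitely many finite terms to the integral of the
    square.\<close>
  have L2_H: "L2_fun ?H v" if "L2_fun ?U v" for v
  proof -
    have [measurable]: "v \<in> borel_measurable (hybrid_measure N)"
      using that by (auto simp: L2_fun_def intro: measurable_hybrid_measureI)
    have "(\<integral>\<^sup>+x. ennreal ((v x)\<^sup>2) \<partial>unit_interval_measure) < \<infinity>"
      using that by (simp add: L2_fun_def integrable_iff_bounded)
    then have "(\<integral>\<^sup>+x. ennreal ((v x)\<^sup>2) \<partial>hybrid_measure N) < \<infinity>"
      by (subst nn_integral_H) auto
    then show ?thesis
      by (simp add: L2_fun_def integrable_iff_bounded)
  qed
  \<comment> \<open>Atoms lie at distance at least 1 from each other and from the interval, so the kernel is
    singular only on the part governed by the Gagliardo seminorm.\<close>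
  have gagliardo_H: "gagliardo_integrable ?H \<alpha> v" if v: "v \<in> frac_sobolev \<alpha>" for v
  proof -
    interpret H: finite_measure "hybrid_measure N"
      by (rule finite_measure_hybrid_measure)
    interpret U: sigma_finite_measure unit_interval_measure
      by (rule sigma_finite_unit_interval_measure)
    define F where "F x y = ennreal (\<bar>v x - v y\<bar>\<^sup>2 / \<bar>x - y\<bar> powr (1 + 2 * \<alpha>))" for x y
    have vU: "v \<in> borel_measurable ?U" "integrable ?U (\<lambda>x. (v x)\<^sup>2)"
      and gU: "gagliardo_integrable ?U \<alpha> v"
      using v by (auto simp: frac_sobolev_iff L2_fun_def)
    have vH[measurable]: "v \<in> borel_measurable ?H"
      using vU(1) by (rule measurable_hybrid_measureI)
    have [measurable]: "(\<lambda>x. x) \<in> borel_measurable ?H"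
      by (rule measurable_id_hybrid)
    have F[measurable]: "(\<lambda>p. F (fst p) (snd p)) \<in> borel_measurable (?H \<Otimes>\<^sub>M ?H)"
      using measurable_difference_kernel(1)[OF measurable_id_hybrid vH]
        measurable_difference_kernel(2)[OF measurable_id_hybrid vH, of "1 + 2 * \<alpha>"]
      unfolding F_def divide_inverse by measurable
    have Fk: "F x (real k) \<le> ennreal (2 * (v x)\<^sup>2 + 2 * (v (real k))\<^sup>2)" if "x \<in> {0<..<1}" "2 \<le> k" for x k
      unfolding F_def using that \<open>0 < \<alpha>\<close> by (intro ennreal_leI difference_quotient_le) auto
    \<comment> \<open>The bound \<open>Fk\<close> is integrable: v is in L^2 and constants are
      integrable on a finite measure.\<close>
    have finU: "(\<integral>\<^sup>+x. F x (real k) \<partial>?U) < \<infinity>" if "2 \<le> k" for k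
    proof -
      have "integrable ?U (\<lambda>x. 2 * (v x)\<^sup>2 + 2 * (v (real k))\<^sup>2)"
        using vU(2) by (simp add: finite_measure.integrable_const[OF finite_measure_unit_interval_measure])
      then have "(\<integral>\<^sup>+x. ennreal (2 * (v x)\<^sup>2 + 2 * (v (real k))\<^sup>2) \<partial>?U) < \<infinity>"
        by (simp add: integrable_iff_bounded)
      moreover have "(\<integral>\<^sup>+x. F x (real k) \<partial>?U) \<le> (\<integral>\<^sup>+x. ennreal (2 * (v x)\<^sup>2 + 2 * (v (real k))\<^sup>2) \<partial>?U)"
        using Fk that by (intro nn_integral_mono) (auto simp: space_restrict_space)
      ultimately show ?thesis
        by (rule le_less_trans[rotated])
    qed
    \<comment> \<open>Symmetry reduces the atom-interval block to the interval-atom block bounded in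
      \<open>finU\<close>.\<close>
    have sym: "F x y = F y x" for x y
      by (simp add: F_def abs_minus_commute)
    have space: "real k \<in> space ?H" if "k \<in> {2..N+1}" for k
      using that unfolding space_hybrid_measure hybrid_set_def hybrid_atoms_def by blast
    have sect: "(\<lambda>y. F x y) \<in> borel_measurable ?H" if "x \<in> space ?H" for x
      using measurable_compose[OF measurable_Pair1'[OF that] F] by simp
    have inner: "(\<integral>\<^sup>+y. F x y \<partial>?H) = (\<integral>\<^sup>+y. F x y \<partial>?U) + (\<Sum>k\<in>{2..N+1}. F x (real k))"
      if "x \<in> space ?H" for x
      using sect[OF that] by (rule nn_integral_H)
    \<comment> \<open>Applying \<open>nn_integral_H\<close> in each variable splits the double
      integral into four blocks: interval-interval, the two mixed ones, and atom-atom.\<close>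
    have "(\<integral>\<^sup>+x. (\<integral>\<^sup>+y. F x y \<partial>?H) \<partial>?H) =
        (\<integral>\<^sup>+x. (\<integral>\<^sup>+y. F x y \<partial>?H) \<partial>?U) + (\<Sum>k\<in>{2..N+1}. \<integral>\<^sup>+y. F (real k) y \<partial>?H)"
      by (rule nn_integral_H) (use H.borel_measurable_nn_integral_fst[OF F] in simp)
    also have "(\<integral>\<^sup>+x. (\<integral>\<^sup>+y. F x y \<partial>?H) \<partial>?U) =
        (\<integral>\<^sup>+x. (\<integral>\<^sup>+y. F x y \<partial>?U) + (\<Sum>k\<in>{2..N+1}. F x (real k)) \<partial>?U)"
      by (intro nn_integral_cong inner) (auto simp: space_restrict_space space_hybrid_measure hybrid_set_def)
    also have "\<dots> = (\<integral>\<^sup>+x. (\<integral>\<^sup>+y. F x y \<partial>?U) \<partial>?U) + (\<Sum>k\<in>{2..N+1}. \<integral>\<^sup>+x. F x (real k) \<partial>?U)"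
    proof -
      have "(\<lambda>p. F (fst p) (snd p)) \<in> borel_measurable (?U \<Otimes>\<^sub>M ?U)"
        using measurable_difference_kernel(1)[OF measurable_id_unit_interval vU(1)]
          measurable_difference_kernel(2)[OF measurable_id_unit_interval vU(1), of "1 + 2 * \<alpha>"]
        unfolding F_def divide_inverse by measurable
      then have "(\<lambda>x. \<integral>\<^sup>+y. F x y \<partial>?U) \<in> borel_measurable ?U"
        using U.borel_measurable_nn_integral_fst by fastforce
      moreover have m: "(\<lambda>x. F x (real k)) \<in> borel_measurable ?U" if "k \<in> {2..N+1}" for k
        using sect[OF space[OF that]] by (subst sym) (rule measurable_hybrid_measureD)
      ultimately have "(\<integral>\<^sup>+x. (\<integral>\<^sup>+y. F x y \<partial>?U) + (\<Sum>k\<in>{2..N+1}. F x (real k)) \<partial>?U) =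
          (\<integral>\<^sup>+x. (\<integral>\<^sup>+y. F x y \<partial>?U) \<partial>?U) + (\<integral>\<^sup>+x. (\<Sum>k\<in>{2..N+1}. F x (real k)) \<partial>?U)"
        by (intro nn_integral_add borel_measurable_sum)
      also have "(\<integral>\<^sup>+x. (\<Sum>k\<in>{2..N+1}. F x (real k)) \<partial>?U) = (\<Sum>k\<in>{2..N+1}. \<integral>\<^sup>+x. F x (real k) \<partial>?U)"
        by (intro nn_integral_sum m)
      finally show ?thesis .
    qed
    also have "(\<Sum>k\<in>{2..N+1}. \<integral>\<^sup>+y. F (real k) y \<partial>?H) =
        (\<Sum>k\<in>{2..N+1}. (\<integral>\<^sup>+y. F y (real k) \<partial>?U) + (\<Sum>l\<in>{2..N+1}. F (real k) (real l)))"
    proof (intro sum.cong refl)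
      fix k assume "k \<in> {2..N+1}"
      then show "(\<integral>\<^sup>+y. F (real k) y \<partial>?H) =
          (\<integral>\<^sup>+y. F y (real k) \<partial>?U) + (\<Sum>l\<in>{2..N+1}. F (real k) (real l))"
        using inner[OF space, of k] by (subst sym[of _ "real k"])
    qed
    \<comment> \<open>The first block is the Gagliardo seminorm, the mixed ones are finite by
      \<open>finU\<close>, and the atom-atom block is a finite sum of finite values.\<close>
    also have "(\<integral>\<^sup>+x. (\<integral>\<^sup>+y. F x y \<partial>?U) \<partial>?U) + (\<Sum>k\<in>{2..N+1}. \<integral>\<^sup>+x. F x (real k) \<partial>?U) + \<dots> < \<infinity>"
    proof -
      have "(\<integral>\<^sup>+x. (\<integral>\<^sup>+y. F x y \<partial>?U) \<partial>?U) < \<infinity>"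
        unfolding F_def
        using gagliardo_integrable_iff[OF U.sigma_finite_measure_axioms measurable_id_unit_interval vU(1)] gU
        by blast
      moreover have "F x y < \<infinity>" for x y
        by (simp add: F_def)
      ultimately show ?thesis
        using finU by (simp del: sum.cl_ivl_Suc)
    qed
    finally show ?thesis
      unfolding F_def by (simp only: gagliardo_integrable_iff[OF H.sigma_finite_measure_axioms measurable_id_hybrid vH])
  qed
  \<comment> \<open>\<open>?res\<close> is the residual L and \<open>?Q\<close> the quadratic
    coefficient; the halves in the functional cancel the factor 2 of the cross terms.\<close>
  let ?res = "\<lambda>v \<phi>. hybrid_form N \<alpha> v \<phi> + lam * (\<integral>x. v x * \<phi> x \<partial>?H) - (\<integral>x. f x * \<phi> x \<partial>?H)"
  let ?Q = "\<lambda>\<phi>. 1 / 2 * hybrid_energy N \<alpha> \<phi> + lam / 2 * (L2_fun_norm ?H \<phi>)\<^sup>2"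
  let ?k = "\<lambda>p. inverse (\<bar>fst p - snd p\<bar> powr (1 + 2 * \<alpha>))"
  have energy_eq: "hybrid_energy N \<alpha> w = (\<integral>p. (w (fst p) - w (snd p))\<^sup>2 * ?k p \<partial>(?H \<Otimes>\<^sub>M ?H))" for w
    by (simp add: hybrid_energy_def case_prod_beta' divide_inverse)
  have expansion: "?J (\<lambda>x. v x + t * \<phi> x) = ?J v + t * ?res v \<phi> + t\<^sup>2 * ?Q \<phi>"
    if v: "v \<in> hybrid_space N \<alpha>" and \<phi>: "\<phi> \<in> hybrid_space N \<alpha>" for v \<phi> t
  proof -
    have L2: "L2_fun ?H v" "L2_fun ?H \<phi>"
      using v \<phi> by (auto simp: hybrid_space_iff frac_sobolev_iff intro: L2_H)
    then have meas: "v \<in> borel_measurable ?H" "\<phi> \<in> borel_measurable ?H"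
      by (auto simp: L2_fun_def)
    have G: "gagliardo_integrable ?H \<alpha> v" "gagliardo_integrable ?H \<alpha> \<phi>"
      using v \<phi> \<open>0 < \<alpha>\<close> by (auto simp: hybrid_space_iff intro: gagliardo_H)
    have eq: "v x + t * \<phi> x - (v y + t * \<phi> y) = (v x - v y) + t * (\<phi> x - \<phi> y)" for x y
      by (simp add: algebra_simps)
    have "hybrid_form N \<alpha> v \<phi> = (\<integral>p. (v (fst p) - v (snd p)) * (\<phi> (fst p) - \<phi> (snd p)) * ?k p \<partial>(?H \<Otimes>\<^sub>M ?H))"
      by (simp add: hybrid_form_def case_prod_beta' divide_inverse)
    then have energy: "hybrid_energy N \<alpha> (\<lambda>x. v x + t * \<phi> x) =
        hybrid_energy N \<alpha> v + 2 * t * hybrid_form N \<alpha> v \<phi> + t\<^sup>2 * hybrid_energy N \<alpha> \<phi>"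
      unfolding energy_eq eq
      using weighted_square_expansion(2)[OF measurable_difference_kernel(1)[OF measurable_id_hybrid meas(1)]
          measurable_difference_kernel(1)[OF measurable_id_hybrid meas(2)]
          measurable_difference_kernel(2)[OF measurable_id_hybrid meas(1)]
          _ G[unfolded gagliardo_integrable_def]]
      by simp
    have norm: "(\<integral>x. (v x + t * \<phi> x)\<^sup>2 \<partial>?H) =
        (\<integral>x. (v x)\<^sup>2 \<partial>?H) + 2 * t * (\<integral>x. v x * \<phi> x \<partial>?H) + t\<^sup>2 * (\<integral>x. (\<phi> x)\<^sup>2 \<partial>?H)"
      using weighted_square_expansion(2)[of v ?H \<phi> "\<lambda>_. 1" t] L2 by (simp add: L2_fun_def)
    \<comment> \<open>Products of two L^2 functions are integrable, so the load term really is
      additive.\<close>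
    have "integrable ?H (\<lambda>x. f x * v x)" "integrable ?H (\<lambda>x. f x * \<phi> x)"
      using integrable_weighted_product[of f ?H _ "\<lambda>_. 1"] L2 \<open>L2_fun ?H f\<close> by (auto simp: L2_fun_def)
    then have lin: "(\<integral>x. f x * (v x + t * \<phi> x) \<partial>?H) = (\<integral>x. f x * v x \<partial>?H) + t * (\<integral>x. f x * \<phi> x \<partial>?H)"
      by (simp add: distrib_left mult.left_commute)
    show ?thesis
      unfolding hybrid_functional_def L2_fun_norm_sq energy norm lin
      by (simp add: field_simps)
  qed
  show "hybrid_minimizers N \<alpha> lam f = hybrid_weak_solutions N \<alpha> lam f"
  proof (intro set_eqI iffI)
    fix v assume v: "v \<in> hybrid_minimizers N \<alpha> lam f"
    then have vS: "v \<in> hybrid_space N \<alpha>"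
      by (simp add: hybrid_minimizers_def)
    have "?res v \<phi> = 0" if \<phi>: "\<phi> \<in> hybrid_space N \<alpha>" for \<phi>
    proof (rule linear_coeff_eq_0_if_quadratic_nonneg)
      fix t
      \<comment> \<open>The competitor must be extensional to belong to the space, hence the detour
        through \<open>restrict\<close>.\<close>
      have "?J v \<le> ?J (restrict (\<lambda>x. v x + t * \<phi> x) (hybrid_set N))"
        using v hybrid_space_add_scaled[OF vS \<phi>] by (simp add: hybrid_minimizers_def)
      also have "\<dots> = ?J (\<lambda>x. v x + t * \<phi> x)"
        by (rule hybrid_functional_cong) simp
      finally show "0 \<le> t * ?res v \<phi> + t\<^sup>2 * ?Q \<phi>"
        unfolding expansion[OF vS \<phi>] by linarith
    qed
    then show "v \<in> hybrid_weak_solutions N \<alpha> lam f"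
      using vS by (simp add: hybrid_weak_solutions_def)
  next
    fix v assume v: "v \<in> hybrid_weak_solutions N \<alpha> lam f"
    then have vS: "v \<in> hybrid_space N \<alpha>"
      by (simp add: hybrid_weak_solutions_def)
    have "?J v \<le> ?J w" if w: "w \<in> hybrid_space N \<alpha>" for w
    proof -
      \<comment> \<open>With d = w - v the parameter t = 1 reaches w. The linear term vanishes by
        the weak equation, leaving the nonnegative \<open>?Q d\<close>.\<close>
      define d where "d = restrict (\<lambda>x. w x + (- 1) * v x) (hybrid_set N)"
      have d: "d \<in> hybrid_space N \<alpha>"
        unfolding d_def using w vS by (rule hybrid_space_add_scaled)
      have "?J v \<le> ?J (\<lambda>x. v x + 1 * d x)"
        unfolding expansion[OF vS d] using v d \<open>0 \<le> lam\<close> hybrid_energy_nonneg[of N \<alpha> d]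
        by (simp add: hybrid_weak_solutions_def)
      also have "\<dots> = ?J w"
        by (rule hybrid_functional_cong) (simp add: d_def)
      finally show ?thesis .
    qed
    then show "v \<in> hybrid_minimizers N \<alpha> lam f"
      using vS by (simp add: hybrid_minimizers_def)
  qed
qed

theorem theorem3p3:
  fixes N :: nat and \<alpha> lam :: real and f u :: "real \<Rightarrow> real"
  assumes "N \<ge> 2" and "0 < \<alpha>" and "\<alpha> < 1" and "lam > 0"
    and "L2_fun (hybrid_measure N) f"
    and "u \<in> hybrid_space N \<alpha>"
  shows "unique_member_AE (hybrid_measure N) (hybrid_minimizers N \<alpha> lam f) u \<longleftrightarrow>
         unique_member_AE (hybrid_measure N) (hybrid_weak_solutions N \<alpha> lam f) u"
  \<comment> \<open>\<open>unique_member_AE\<close> sees the problem only through its solution set,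
    and the two sets are equal.\<close>
  using assms by (simp add: hybrid_minimizers_eq_weak_solutions)

end
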